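(* Let $\mathcal{E}$ be a cartesian closed category with a homotopy theory $p:1_{\mathcal{E}}\Rightarrow\Pi_0$. Let $A\in\mathcal{E}$ and, for any object $X$, let $\sigma_X:X\to X^A$ be the transpose of the projection $X\times A\to X$. The following are equivalent: (1) The object $A$ is $p$-contractible. (2) For every object $X\in\mathcal{E}$, $\Pi_0(\sigma_X):\Pi_0(X)\to\Pi_0(X^A)$ is an isomorphism. Moreover, when $\mathcal{E}$ is a topos satisfying NS, WDQO and DSO and $p:1_{\mathcal{E}}\Rightarrow\Pi_0=\mathcal{I}\Pi$ is the associated homotopy theory, (1) and (2) are also equivalent to each of the following: (3) For every $X\in\mathcal{E}$, $A^X$ is connected. (4) The object $A$ has a point and $A^A$ is connected.
   Context: A homotopy theory on a cartesian closed category $\mathcal{E}$ is a natural transformation $p:1_{\mathcal{E}}\Rightarrow\Pi_0:\mathcal{E}\to\mathcal{E}$ with $\Pi_0$ preserving finite products and $\mathcal{E}(1,p_X):\mathcal{E}(1,X)\to\mathcal{E}(1,\Pi_0(X))$ surjective for every $X$. The name $\ulcorner f\urcorner:1\to Y^X$ of $f:X\to Y$ is the transpose of $f\circ\pi_X:1\times X\to Y$. Arrows $f,g:X\to Y$ are $p$-homotopic if $p_{Y^X}\circ\ulcorner f\urcorner=p_{Y^X}\circ\ulcorner g\urcorner$. An object $A$ is connected if $\Pi_0(A)=1$ (is terminal). An object $A$ is $p$-contractible if it has a point $a:1\to A$ such that $1_A$ is $p$-homotopic to the constant map $a!:A\to1\to A$. An object of a topos is decidable if its diagonal is a complemented subobject;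 $\mathcal{I}:\mathrm{Dec}(\mathcal{E})\to\mathcal{E}$ is the inclusion of the full subcategory of decidable objects. NS: every non-initial object has a point (an arrow from $1$). WDQO: for every object $X$ there is a minimal decidable object, $p_X:X\to\Pi(X)$ with $\Pi(X)$ decidable, such that every arrow $X\to1+1$ factors uniquely through $p_X$. DSO: for every object $X$ there is a unique decidable subobject $\gamma_X:\Gamma X\rightarrowtail X$ containing all the points of $X$. For a topos satisfying NS and WDQO, $\Pi$ is a finite-product-preserving functor left adjoint to $\mathcal{I}$ with unit $p$, and $p:1_{\mathcal{E}}\Rightarrow\mathcal{I}\Pi$ is a homotopy theory (the associated one). *)

theory Defs
  imports Main
begin

section \<open>Categories\<close>

text \<open>\<open>Comp C g f\<close> is \<open>g\<close> after \<open>f\<close>; it is only constrained on composable pairs of arrows.\<close>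

record ('o, 'm) category =
  Obj :: "'o set"
  Arr :: "'m set"
  Dom :: "'m \<Rightarrow> 'o"
  Cod :: "'m \<Rightarrow> 'o"
  Ident :: "'o \<Rightarrow> 'm"
  Comp :: "'m \<Rightarrow> 'm \<Rightarrow> 'm"

definition hom :: "('o, 'm, 'z) category_scheme \<Rightarrow> 'o \<Rightarrow> 'o \<Rightarrow> 'm set" where
  "hom C X Y = {f \<in> Arr C. Dom C f = X \<and> Cod C f = Y}"

locale category =
  fixes C :: "('o, 'm, 'z) category_scheme"
  assumes Dom_Obj: "f \<in> Arr C \<Longrightarrow> Dom C f \<in> Obj C"
    and Cod_Obj: "f \<in> Arr C \<Longrightarrow> Cod C f \<in> Obj C"
    and Ident_hom: "X \<in> Obj C \<Longrightarrow> Ident C X \<in> hom C X X"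
    and Comp_hom: "\<lbrakk>f \<in> hom C X Y; g \<in> hom C Y Z\<rbrakk> \<Longrightarrow> Comp C g f \<in> hom C X Z"
    and Comp_Ident_left: "f \<in> hom C X Y \<Longrightarrow> Comp C (Ident C Y) f = f"
    and Comp_Ident_right: "f \<in> hom C X Y \<Longrightarrow> Comp C f (Ident C X) = f"
    and Comp_assoc: "\<lbrakk>f \<in> hom C W X; g \<in> hom C X Y; h \<in> hom C Y Z\<rbrakk>
      \<Longrightarrow> Comp C h (Comp C g f) = Comp C (Comp C h g) f"

definition is_iso :: "('o, 'm, 'z) category_scheme \<Rightarrow> 'm \<Rightarrow> bool" where
  "is_iso C f \<longleftrightarrow> f \<in> Arr C \<and> (\<exists>g \<in> hom C (Cod C f) (Dom C f).
     Comp C g f = Ident C (Dom C f) \<and> Comp C f g = Ident C (Cod C f))"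

definition is_mono :: "('o, 'm, 'z) category_scheme \<Rightarrow> 'm \<Rightarrow> bool" where
  "is_mono C m \<longleftrightarrow> m \<in> Arr C \<and> (\<forall>Z \<in> Obj C. \<forall>f \<in> hom C Z (Dom C m). \<forall>g \<in> hom C Z (Dom C m).
     Comp C m f = Comp C m g \<longrightarrow> f = g)"

definition is_terminal :: "('o, 'm, 'z) category_scheme \<Rightarrow> 'o \<Rightarrow> bool" where
  "is_terminal C T \<longleftrightarrow> T \<in> Obj C \<and> (\<forall>X \<in> Obj C. \<exists>!f. f \<in> hom C X T)"

definition is_initial :: "('o, 'm, 'z) category_scheme \<Rightarrow> 'o \<Rightarrow> bool" where
  "is_initial C I \<longleftrightarrow> I \<in> Obj C \<and> (\<forall>X \<in> Obj C. \<exists>!f. f \<in> hom C I X)"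

definition is_product ::
  "('o, 'm, 'z) category_scheme \<Rightarrow> 'o \<Rightarrow> 'o \<Rightarrow> 'o \<Rightarrow> 'm \<Rightarrow> 'm \<Rightarrow> bool" where
  "is_product C X Y P u v \<longleftrightarrow> P \<in> Obj C \<and> u \<in> hom C P X \<and> v \<in> hom C P Y \<and>
     (\<forall>Z \<in> Obj C. \<forall>f \<in> hom C Z X. \<forall>g \<in> hom C Z Y.
        \<exists>!h. h \<in> hom C Z P \<and> Comp C u h = f \<and> Comp C v h = g)"

definition is_coproduct ::
  "('o, 'm, 'z) category_scheme \<Rightarrow> 'o \<Rightarrow> 'o \<Rightarrow> 'o \<Rightarrow> 'm \<Rightarrow> 'm \<Rightarrow> bool" where
  "is_coproduct C X Y S i j \<longleftrightarrow> S \<in> Obj C \<and> i \<in> hom C X S \<and> j \<in> hom C Y S \<and>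
     (\<forall>Z \<in> Obj C. \<forall>f \<in> hom C X Z. \<forall>g \<in> hom C Y Z.
        \<exists>!h. h \<in> hom C S Z \<and> Comp C h i = f \<and> Comp C h j = g)"

text \<open>In \<open>is_pullback C f g u v\<close> the cospan is \<open>f\<close>, \<open>g\<close> and the
  commuting square is \<open>Comp C f u = Comp C g v\<close>.\<close>

definition is_pullback ::
  "('o, 'm, 'z) category_scheme \<Rightarrow> 'm \<Rightarrow> 'm \<Rightarrow> 'm \<Rightarrow> 'm \<Rightarrow> bool" where
  "is_pullback C f g u v \<longleftrightarrow>
     {f, g, u, v} \<subseteq> Arr C \<and> Cod C f = Cod C g \<and> Dom C u = Dom C v \<and>
     Cod C u = Dom C f \<and> Cod C v = Dom C g \<and> Comp C f u = Comp C g v \<and>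
     (\<forall>Z \<in> Obj C. \<forall>a \<in> hom C Z (Dom C f). \<forall>b \<in> hom C Z (Dom C g). Comp C f a = Comp C g b \<longrightarrow>
        (\<exists>!h. h \<in> hom C Z (Dom C u) \<and> Comp C u h = a \<and> Comp C v h = b))"

section \<open>Subobjects\<close>

text \<open>A subobject is represented by a monomorphism; two monomorphisms represent the same
  subobject iff each factors through the other.\<close>

definition factors_through :: "('o, 'm, 'z) category_scheme \<Rightarrow> 'm \<Rightarrow> 'm \<Rightarrow> bool" where
  "factors_through C f m \<longleftrightarrow> (\<exists>h \<in> hom C (Dom C f) (Dom C m). Comp C m h = f)"

definition is_subobject :: "('o, 'm, 'z) category_scheme \<Rightarrow> 'm \<Rightarrow> 'o \<Rightarrow> bool" where
  "is_subobject C m X \<longleftrightarrow> is_mono C m \<and> Cod C m = X"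

text \<open>Complements are taken in the lattice of subobjects of \<open>X\<close>: the meet of \<open>m\<close> and \<open>n\<close> is the
  bottom element (every common lower bound is below everything) and their join is the top
  element (every common upper bound is above everything).\<close>

definition complementary ::
  "('o, 'm, 'z) category_scheme \<Rightarrow> 'o \<Rightarrow> 'm \<Rightarrow> 'm \<Rightarrow> bool" where
  "complementary C X m n \<longleftrightarrow>
     (\<forall>k. is_subobject C k X \<and> factors_through C k m \<and> factors_through C k n \<longrightarrow>
        (\<forall>l. is_subobject C l X \<longrightarrow> factors_through C k l)) \<and>
     (\<forall>k. is_subobject C k X \<and> factors_through C m k \<and> factors_through C n k \<longrightarrow>
        (\<forall>l. is_subobject C l X \<longrightarrow> factors_through C l k))"

definition complemented_subobject ::
  "('o, 'm, 'z) category_scheme \<Rightarrow> 'm \<Rightarrow> 'o \<Rightarrow> bool" where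
  "complemented_subobject C m X \<longleftrightarrow>
     is_subobject C m X \<and> (\<exists>n. is_subobject C n X \<and> complementary C X m n)"

section \<open>Cartesian closed categories\<close>

text \<open>\<open>Exp E Y X\<close> is the exponential \<open>Y\<^sup>X\<close> and \<open>Eval E Y X : Y\<^sup>X \<times> X \<rightarrow> Y\<close> its evaluation.\<close>

record ('o, 'm) ccc = "('o, 'm) category" +
  One :: 'o
  Prod :: "'o \<Rightarrow> 'o \<Rightarrow> 'o"
  Proj1 :: "'o \<Rightarrow> 'o \<Rightarrow> 'm"
  Proj2 :: "'o \<Rightarrow> 'o \<Rightarrow> 'm"
  Exp :: "'o \<Rightarrow> 'o \<Rightarrow> 'o"
  Eval :: "'o \<Rightarrow> 'o \<Rightarrow> 'm"

definition bang :: "('o, 'm, 'z) ccc_scheme \<Rightarrow> 'o \<Rightarrow> 'm" where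
  "bang E X = (THE f. f \<in> hom E X (One E))"

definition pairing :: "('o, 'm, 'z) ccc_scheme \<Rightarrow> 'm \<Rightarrow> 'm \<Rightarrow> 'm" where
  "pairing E f g = (THE h. h \<in> hom E (Dom E f) (Prod E (Cod E f) (Cod E g)) \<and>
     Comp E (Proj1 E (Cod E f) (Cod E g)) h = f \<and>
     Comp E (Proj2 E (Cod E f) (Cod E g)) h = g)"

definition prod_map :: "('o, 'm, 'z) ccc_scheme \<Rightarrow> 'm \<Rightarrow> 'm \<Rightarrow> 'm" where
  "prod_map E f g = pairing E (Comp E f (Proj1 E (Dom E f) (Dom E g)))
                              (Comp E g (Proj2 E (Dom E f) (Dom E g)))"

definition is_transpose ::
  "('o, 'm, 'z) ccc_scheme \<Rightarrow> 'o \<Rightarrow> 'o \<Rightarrow> 'o \<Rightarrow> 'm \<Rightarrow> 'm \<Rightarrow> bool" where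
  "is_transpose E Z X Y f h \<longleftrightarrow>
     h \<in> hom E Z (Exp E Y X) \<and> Comp E (Eval E Y X) (prod_map E h (Ident E X)) = f"

locale cartesian_closed_category = category E
  for E :: "('o, 'm, 'z) ccc_scheme" +
  assumes One_terminal: "is_terminal E (One E)"
    and Prod_product: "\<lbrakk>X \<in> Obj E; Y \<in> Obj E\<rbrakk>
      \<Longrightarrow> is_product E X Y (Prod E X Y) (Proj1 E X Y) (Proj2 E X Y)"
    and Exp_Obj: "\<lbrakk>X \<in> Obj E; Y \<in> Obj E\<rbrakk> \<Longrightarrow> Exp E Y X \<in> Obj E"
    and Eval_hom: "\<lbrakk>X \<in> Obj E; Y \<in> Obj E\<rbrakk> \<Longrightarrow> Eval E Y X \<in> hom E (Prod E (Exp E Y X) X) Y"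
    and transpose_ex1: "\<lbrakk>X \<in> Obj E; Y \<in> Obj E; Z \<in> Obj E; f \<in> hom E (Prod E Z X) Y\<rbrakk>
      \<Longrightarrow> \<exists>!h. is_transpose E Z X Y f h"

text \<open>\<open>transpose E Z X Y f : Z \<rightarrow> Y\<^sup>X\<close> for \<open>f : Z \<times> X \<rightarrow> Y\<close>.\<close>

definition transpose :: "('o, 'm, 'z) ccc_scheme \<Rightarrow> 'o \<Rightarrow> 'o \<Rightarrow> 'o \<Rightarrow> 'm \<Rightarrow> 'm" where
  "transpose E Z X Y f = (THE h. is_transpose E Z X Y f h)"

definition name_of :: "('o, 'm, 'z) ccc_scheme \<Rightarrow> 'm \<Rightarrow> 'm" where
  "name_of E f = transpose E (One E) (Dom E f) (Cod E f)
                   (Comp E f (Proj2 E (One E) (Dom E f)))"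

definition const_exp :: "('o, 'm, 'z) ccc_scheme \<Rightarrow> 'o \<Rightarrow> 'o \<Rightarrow> 'm" where
  "const_exp E A X = transpose E X A X (Proj1 E X A)"

definition has_point :: "('o, 'm, 'z) ccc_scheme \<Rightarrow> 'o \<Rightarrow> bool" where
  "has_point E X \<longleftrightarrow> hom E (One E) X \<noteq> {}"

section \<open>Homotopy theories\<close>

record ('o, 'm) endofunctor =
  FObj :: "'o \<Rightarrow> 'o"
  FArr :: "'m \<Rightarrow> 'm"

locale endofunctor_on = category C
  for C :: "('o, 'm, 'z) category_scheme" and F :: "('o, 'm) endofunctor" +
  assumes FObj_Obj: "X \<in> Obj C \<Longrightarrow> FObj F X \<in> Obj C"
    and FArr_hom: "f \<in> hom C X Y \<Longrightarrow> FArr F f \<in> hom C (FObj F X) (FObj F Y)"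
    and FArr_Ident: "X \<in> Obj C \<Longrightarrow> FArr F (Ident C X) = Ident C (FObj F X)"
    and FArr_Comp: "\<lbrakk>f \<in> hom C X Y; g \<in> hom C Y Z\<rbrakk>
      \<Longrightarrow> FArr F (Comp C g f) = Comp C (FArr F g) (FArr F f)"

definition preserves_finite_products ::
  "('o, 'm, 'z) category_scheme \<Rightarrow> ('o, 'm) endofunctor \<Rightarrow> bool" where
  "preserves_finite_products C F \<longleftrightarrow>
     (\<forall>T. is_terminal C T \<longrightarrow> is_terminal C (FObj F T)) \<and>
     (\<forall>X \<in> Obj C. \<forall>Y \<in> Obj C. \<forall>P u v. is_product C X Y P u v \<longrightarrow>
        is_product C (FObj F X) (FObj F Y) (FObj F P) (FArr F u) (FArr F v))"

locale homotopy_theory = cartesian_closed_category E + endofunctor_on E \<Pi>\<^sub>0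
  for E :: "('o, 'm, 'z) ccc_scheme" and \<Pi>\<^sub>0 :: "('o, 'm) endofunctor" and p :: "'o \<Rightarrow> 'm" +
  assumes p_hom: "X \<in> Obj E \<Longrightarrow> p X \<in> hom E X (FObj \<Pi>\<^sub>0 X)"
    and p_natural: "f \<in> hom E X Y \<Longrightarrow> Comp E (FArr \<Pi>\<^sub>0 f) (p X) = Comp E (p Y) f"
    and finite_products: "preserves_finite_products E \<Pi>\<^sub>0"
    and points_surj: "X \<in> Obj E \<Longrightarrow>
      (\<lambda>x. Comp E (p X) x) ` hom E (One E) X = hom E (One E) (FObj \<Pi>\<^sub>0 X)"

definition homotopic ::
  "('o, 'm, 'z) ccc_scheme \<Rightarrow> ('o \<Rightarrow> 'm) \<Rightarrow> 'o \<Rightarrow> 'o \<Rightarrow> 'm \<Rightarrow> 'm \<Rightarrow> bool" where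
  "homotopic E p X Y f g \<longleftrightarrow> f \<in> hom E X Y \<and> g \<in> hom E X Y \<and>
     Comp E (p (Exp E Y X)) (name_of E f) = Comp E (p (Exp E Y X)) (name_of E g)"

definition contractible :: "('o, 'm, 'z) ccc_scheme \<Rightarrow> ('o \<Rightarrow> 'm) \<Rightarrow> 'o \<Rightarrow> bool" where
  "contractible E p A \<longleftrightarrow>
     (\<exists>a \<in> hom E (One E) A. homotopic E p A A (Ident E A) (Comp E a (bang E A)))"

definition connected_object ::
  "('o, 'm, 'z) category_scheme \<Rightarrow> ('o, 'm) endofunctor \<Rightarrow> 'o \<Rightarrow> bool" where
  "connected_object E \<Pi>\<^sub>0 A \<longleftrightarrow> is_terminal E (FObj \<Pi>\<^sub>0 A)"

section \<open>Toposes\<close>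

definition is_subobject_classifier :: "('o, 'm, 'z) ccc_scheme \<Rightarrow> 'o \<Rightarrow> 'm \<Rightarrow> bool" where
  "is_subobject_classifier E \<Omega> t \<longleftrightarrow> \<Omega> \<in> Obj E \<and> t \<in> hom E (One E) \<Omega> \<and>
     (\<forall>m. is_mono E m \<longrightarrow>
        (\<exists>!\<chi>. \<chi> \<in> hom E (Cod E m) \<Omega> \<and> is_pullback E \<chi> t m (bang E (Dom E m))))"

text \<open>An elementary topos; the terminal object together with pullbacks gives all finite limits.\<close>

locale topos = cartesian_closed_category E
  for E :: "('o, 'm, 'z) ccc_scheme" +
  assumes pullbacks: "\<lbrakk>f \<in> Arr E; g \<in> Arr E; Cod E f = Cod E g\<rbrakk> \<Longrightarrow> \<exists>u v. is_pullback E f g u v"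
    and classifier: "\<exists>\<Omega> t. is_subobject_classifier E \<Omega> t"

definition decidable :: "('o, 'm, 'z) ccc_scheme \<Rightarrow> 'o \<Rightarrow> bool" where
  "decidable E X \<longleftrightarrow> X \<in> Obj E \<and>
     complemented_subobject E (pairing E (Ident E X) (Ident E X)) (Prod E X X)"

definition NS :: "('o, 'm, 'z) ccc_scheme \<Rightarrow> bool" where
  "NS E \<longleftrightarrow> (\<forall>X \<in> Obj E. \<not> is_initial E X \<longrightarrow> has_point E X)"

text \<open>Every topos has coproducts, so \<open>1 + 1\<close> exists; it is unique up to isomorphism, and
  quantifying over all coproducts of \<open>1\<close> with itself avoids choosing one.\<close>

definition minimal_decidable :: "('o, 'm, 'z) ccc_scheme \<Rightarrow> 'o \<Rightarrow> 'o \<Rightarrow> 'm \<Rightarrow> bool" where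
  "minimal_decidable E X Q q \<longleftrightarrow> decidable E Q \<and> q \<in> hom E X Q \<and>
     (\<forall>T i j. is_coproduct E (One E) (One E) T i j \<longrightarrow>
        (\<forall>f \<in> hom E X T. \<exists>!g. g \<in> hom E Q T \<and> Comp E g q = f))"

definition WDQO :: "('o, 'm, 'z) ccc_scheme \<Rightarrow> bool" where
  "WDQO E \<longleftrightarrow> (\<forall>X \<in> Obj E. \<exists>Q q. minimal_decidable E X Q q)"

definition is_decidable_points_subobject ::
  "('o, 'm, 'z) ccc_scheme \<Rightarrow> 'o \<Rightarrow> 'm \<Rightarrow> bool" where
  "is_decidable_points_subobject E X \<gamma> \<longleftrightarrow> is_subobject E \<gamma> X \<and> decidable E (Dom E \<gamma>) \<and>
     (\<forall>x \<in> hom E (One E) X. factors_through E x \<gamma>)"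

definition DSO :: "('o, 'm, 'z) ccc_scheme \<Rightarrow> bool" where
  "DSO E \<longleftrightarrow> (\<forall>X \<in> Obj E.
     (\<exists>\<gamma>. is_decidable_points_subobject E X \<gamma>) \<and>
     (\<forall>\<gamma> \<gamma>'. is_decidable_points_subobject E X \<gamma> \<and> is_decidable_points_subobject E X \<gamma>' \<longrightarrow>
        factors_through E \<gamma> \<gamma>' \<and> factors_through E \<gamma>' \<gamma>))"

text \<open>The homotopy theory associated with WDQO: since the decidable objects form a full
  subcategory, \<open>\<Pi>\<^sub>0 = \<I>\<Pi>\<close> says exactly that every \<open>\<Pi>\<^sub>0 X\<close> is decidable. The action of
  \<open>\<Pi>\<^sub>0\<close> on arrows is tied to \<open>p\<close> by naturality, which is part of \<open>homotopy_theory\<close>.\<close>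

definition associated_homotopy_theory ::
  "('o, 'm, 'z) ccc_scheme \<Rightarrow> ('o, 'm) endofunctor \<Rightarrow> ('o \<Rightarrow> 'm) \<Rightarrow> bool" where
  "associated_homotopy_theory E \<Pi>\<^sub>0 p \<longleftrightarrow> homotopy_theory E \<Pi>\<^sub>0 p \<and>
     (\<forall>X \<in> Obj E. minimal_decidable E X (FObj \<Pi>\<^sub>0 X) (p X))"

end

theory Submission
  imports Defs
begin

text \<open>Composition \<open>Z\<^sup>Y \<times> Y\<^sup>X \<rightarrow> Z\<^sup>X\<close> is an arrow of \<open>E\<close>, and \<open>\<Pi>\<^sub>0\<close> preserves the product on which
  it is defined and identifies the points \<open>\<ulcorner>1\<^sub>A\<urcorner>\<close> and \<open>\<ulcorner>a!\<urcorner>\<close> of \<open>A\<^sup>A\<close> when \<open>A\<close> contracts to \<open>a\<close>.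
  Composing with these two points therefore gives equal arrows after applying \<open>\<Pi>\<^sub>0\<close>. On \<open>X\<^sup>A\<close>
  (precomposition) the two arrows are the identity and \<open>X\<^sup>A \<rightarrow> X \<rightarrow> X\<^sup>A\<close>, evaluation at \<open>a\<close> followed
  by \<open>\<sigma>\<^sub>X\<close>, so that \<open>\<Pi>\<^sub>0(\<sigma>\<^sub>X)\<close> is invertible. On \<open>A\<^sup>X\<close> (postcomposition) they are the identity and
  an arrow through \<open>1\<close>, so that \<open>\<Pi>\<^sub>0(A\<^sup>X)\<close> is a retract of a terminal object.

  Conversely, invertibility of \<open>\<Pi>\<^sub>0(\<sigma>\<^sub>A)\<close> and surjectivity on points produce the \<open>a\<close> to which
  \<open>A\<close> contracts, and if \<open>\<Pi>\<^sub>0(A\<^sup>A)\<close> is terminal then any two arrows \<open>A \<rightarrow> A\<close> are homotopic. A point of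
  \<open>A\<close> comes from the terminal \<open>\<Pi>\<^sub>0(A\<^sup>1)\<close>, again by surjectivity on points.\<close>

section \<open>Isomorphisms, terminal objects and retracts\<close>

context category
begin

abbreviation compose (infixr "\<cdot>" 55) where "g \<cdot> f \<equiv> Comp C g f"

lemma hom_Obj_Dom: "f \<in> hom C X Y \<Longrightarrow> X \<in> Obj C"
  using Dom_Obj by (auto simp: hom_def)

lemma hom_Obj_Cod: "f \<in> hom C X Y \<Longrightarrow> Y \<in> Obj C"
  using Cod_Obj by (auto simp: hom_def)

lemma hom_DomD: "f \<in> hom C X Y \<Longrightarrow> Dom C f = X"
  and hom_CodD: "f \<in> hom C X Y \<Longrightarrow> Cod C f = Y"
  by (auto simp: hom_def)

lemma is_isoI:
  assumes "f \<in> hom C X Y" "g \<in> hom C Y X" "g \<cdot> f = Ident C X" "f \<cdot> g = Ident C Y"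
  shows "is_iso C f"
  using assms by (auto simp: is_iso_def hom_def)

lemma is_isoE:
  assumes "is_iso C f" "f \<in> hom C X Y"
  obtains g where "g \<in> hom C Y X" "g \<cdot> f = Ident C X" "f \<cdot> g = Ident C Y"
  using assms by (auto simp: is_iso_def hom_def)

lemma terminal_unique:
  assumes "is_terminal C T" "f \<in> hom C X T" "g \<in> hom C X T"
  shows "f = g"
  using assms hom_Obj_Dom[OF assms(2)] unfolding is_terminal_def by blast

text \<open>An arrow \<open>f\<close> into \<open>X\<close> equals
  \<open>r \<cdot> (s \<cdot> f)\<close>, and \<open>s \<cdot> f\<close> lands in the terminal
  \<open>T\<close>, so \<open>f\<close> is forced.\<close>

lemma retract_of_terminal:
  assumes T: "is_terminal C T"
    and r: "r \<in> hom C T X" and s: "s \<in> hom C X T" and rs: "r \<cdot> s = Ident C X"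
  shows "is_terminal C X"
  unfolding is_terminal_def
proof (intro conjI ballI)
  show "X \<in> Obj C" using hom_Obj_Dom[OF s] .
  fix Y assume "Y \<in> Obj C"
  then obtain t where t: "t \<in> hom C Y T" using T unfolding is_terminal_def by blast
  show "\<exists>!f. f \<in> hom C Y X"
  proof (rule ex1I)
    show "r \<cdot> t \<in> hom C Y X" using Comp_hom t r by blast
    fix f assume f: "f \<in> hom C Y X"
    have "f = r \<cdot> (s \<cdot> f)"
      using Comp_assoc[OF f s r] rs Comp_Ident_left[OF f] by simp
    also have "s \<cdot> f = t" using terminal_unique[OF T Comp_hom[OF f s] t] .
    finally show "f = r \<cdot> t" .
  qed
qed

end

section \<open>Terminal object and binary products\<close>

context cartesian_closed_category
begin

notation compose (infixr "\<cdot>" 55)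

lemma One_Obj: "One E \<in> Obj E"
  using One_terminal by (simp add: is_terminal_def)

lemma bang_hom: "X \<in> Obj E \<Longrightarrow> bang E X \<in> hom E X (One E)"
  using theI'[of "\<lambda>f. f \<in> hom E X (One E)"] One_terminal
  by (auto simp: is_terminal_def bang_def)

lemma hom_One_eq: "\<lbrakk>f \<in> hom E X (One E); g \<in> hom E X (One E)\<rbrakk> \<Longrightarrow> f = g"
  by (rule terminal_unique[OF One_terminal])

lemma bang_Comp: "f \<in> hom E X Y \<Longrightarrow> bang E Y \<cdot> f = bang E X"
  using hom_One_eq[OF Comp_hom[OF _ bang_hom[OF hom_Obj_Cod]] bang_hom[OF hom_Obj_Dom]] by blast

lemma Prod_Obj: "\<lbrakk>X \<in> Obj E; Y \<in> Obj E\<rbrakk> \<Longrightarrow> Prod E X Y \<in> Obj E"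
  and Proj1_hom: "\<lbrakk>X \<in> Obj E; Y \<in> Obj E\<rbrakk> \<Longrightarrow> Proj1 E X Y \<in> hom E (Prod E X Y) X"
  and Proj2_hom: "\<lbrakk>X \<in> Obj E; Y \<in> Obj E\<rbrakk> \<Longrightarrow> Proj2 E X Y \<in> hom E (Prod E X Y) Y"
  using Prod_product[of X Y] by (auto simp: is_product_def)

lemma pairing_ex1:
  assumes "f \<in> hom E Z X" "g \<in> hom E Z Y"
  shows "\<exists>!h. h \<in> hom E Z (Prod E X Y) \<and> Proj1 E X Y \<cdot> h = f \<and> Proj2 E X Y \<cdot> h = g"
  using Prod_product[OF hom_Obj_Cod[OF assms(1)] hom_Obj_Cod[OF assms(2)]] assms
    hom_Obj_Dom[OF assms(1)]
  unfolding is_product_def by blast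

lemma
  assumes "f \<in> hom E Z X" "g \<in> hom E Z Y"
  shows pairing_hom: "pairing E f g \<in> hom E Z (Prod E X Y)"
    and Proj1_pairing: "Proj1 E X Y \<cdot> pairing E f g = f"
    and Proj2_pairing: "Proj2 E X Y \<cdot> pairing E f g = g"
  using theI'[OF pairing_ex1[OF assms]] assms[THEN hom_DomD] assms[THEN hom_CodD]
  unfolding pairing_def by auto

lemma pairing_unique:
  assumes "h \<in> hom E Z (Prod E X Y)" "Proj1 E X Y \<cdot> h = f" "Proj2 E X Y \<cdot> h = g"
    "f \<in> hom E Z X" "g \<in> hom E Z Y"
  shows "h = pairing E f g"
  using pairing_ex1[OF assms(4,5)] assms(1-3)
    pairing_hom[OF assms(4,5)] Proj1_pairing[OF assms(4,5)] Proj2_pairing[OF assms(4,5)] by blast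

lemma pairing_Comp:
  assumes f: "f \<in> hom E Z X" and g: "g \<in> hom E Z Y" and k: "k \<in> hom E W Z"
  shows "pairing E f g \<cdot> k = pairing E (f \<cdot> k) (g \<cdot> k)"
proof (rule pairing_unique)
  note o = hom_Obj_Cod[OF f] hom_Obj_Cod[OF g]
  note fg = pairing_hom[OF f g]
  show "pairing E f g \<cdot> k \<in> hom E W (Prod E X Y)" by (rule Comp_hom[OF k fg])
  show "Proj1 E X Y \<cdot> pairing E f g \<cdot> k = f \<cdot> k"
    using Comp_assoc[OF k fg Proj1_hom[OF o]] Proj1_pairing[OF f g] by simp
  show "Proj2 E X Y \<cdot> pairing E f g \<cdot> k = g \<cdot> k"
    using Comp_assoc[OF k fg Proj2_hom[OF o]] Proj2_pairing[OF f g] by simp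
  show "f \<cdot> k \<in> hom E W X" "g \<cdot> k \<in> hom E W Y" using Comp_hom[OF k f] Comp_hom[OF k g] .
qed

section \<open>Exponentials through generalized elements\<close>

text \<open>Application at stage \<open>Z\<close>: \<open>h\<close> is a generalized element of the
  exponential and \<open>t\<close> one of its argument object. With \<open>app_Comp\<close> as
  change of stage, equations between arrows into an exponential become pointwise
  calculations.\<close>

definition app :: "'o \<Rightarrow> 'o \<Rightarrow> 'm \<Rightarrow> 'm \<Rightarrow> 'm" where
  "app X Y h t = Eval E Y X \<cdot> pairing E h t"

lemma app_hom:
  assumes "h \<in> hom E Z (Exp E Y X)" "t \<in> hom E Z X" "Y \<in> Obj E"
  shows "app X Y h t \<in> hom E Z Y"
  unfolding app_def
  using Comp_hom[OF pairing_hom[OF assms(1,2)] Eval_hom[OF hom_Obj_Cod[OF assms(2)] assms(3)]] .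

lemma app_Comp:
  assumes "h \<in> hom E Z (Exp E Y X)" "t \<in> hom E Z X" "Y \<in> Obj E" "k \<in> hom E W Z"
  shows "app X Y h t \<cdot> k = app X Y (h \<cdot> k) (t \<cdot> k)"
  unfolding app_def
  using Comp_assoc[OF assms(4) pairing_hom[OF assms(1,2)]
      Eval_hom[OF hom_Obj_Cod[OF assms(2)] assms(3)]] pairing_Comp[OF assms(1,2,4)] by simp

text \<open>The map \<open>prod_map E h (Ident E X)\<close> pairs \<open>h\<close> after the first
  projection with the second projection, so being a transpose is a condition on the value at the
  generic argument \<open>Proj2 E Z X\<close>.\<close>

lemma is_transpose_iff:
  assumes h: "h \<in> hom E Z (Exp E Y X)" and X: "X \<in> Obj E"
  shows "is_transpose E Z X Y f h \<longleftrightarrow> app X Y (h \<cdot> Proj1 E Z X) (Proj2 E Z X) = f"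
  using h X hom_Obj_Dom[OF h] Comp_Ident_left[OF Proj2_hom]
  by (simp add: is_transpose_def prod_map_def app_def hom_DomD[OF h] hom_DomD[OF Ident_hom[OF X]])

text \<open>Both arrows are transposes of the same arrow, so they agree by uniqueness. This is the
  function extensionality behind every later equation between arrows into an exponential.\<close>

lemma Exp_ext:
  assumes h: "h \<in> hom E Z (Exp E Y X)" and k: "k \<in> hom E Z (Exp E Y X)"
    and X: "X \<in> Obj E" and Y: "Y \<in> Obj E"
    and eq: "app X Y (h \<cdot> Proj1 E Z X) (Proj2 E Z X) = app X Y (k \<cdot> Proj1 E Z X) (Proj2 E Z X)"
  shows "h = k"
proof -
  note Z = hom_Obj_Dom[OF h]
  have "app X Y (h \<cdot> Proj1 E Z X) (Proj2 E Z X) \<in> hom E (Prod E Z X) Y"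
    using app_hom[OF Comp_hom[OF Proj1_hom[OF Z X] h] Proj2_hom[OF Z X] Y] .
  from transpose_ex1[OF X Y Z this] show ?thesis
    using is_transpose_iff[OF h X] is_transpose_iff[OF k X] eq by metis
qed

lemma
  assumes f: "f \<in> hom E (Prod E Z X) Y" and X: "X \<in> Obj E" and Z: "Z \<in> Obj E"
  shows transpose_hom: "transpose E Z X Y f \<in> hom E Z (Exp E Y X)"
    and app_transpose_Proj:
      "app X Y (transpose E Z X Y f \<cdot> Proj1 E Z X) (Proj2 E Z X) = f"
proof -
  have *: "is_transpose E Z X Y f (transpose E Z X Y f)"
    unfolding transpose_def by (rule theI'[OF transpose_ex1[OF X hom_Obj_Cod[OF f] Z f]])
  then show "transpose E Z X Y f \<in> hom E Z (Exp E Y X)" by (simp add: is_transpose_def)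
  from is_transpose_iff[OF this X] *
  show "app X Y (transpose E Z X Y f \<cdot> Proj1 E Z X) (Proj2 E Z X) = f" by simp
qed

text \<open>The beta rule: \<open>k\<close> and \<open>t\<close> arise from the two projections by
  composing with \<open>pairing E k t\<close>, and \<open>app_Comp\<close> carries this substitution
  through the defining equation of the transpose.\<close>

lemma app_transpose:
  assumes f: "f \<in> hom E (Prod E Z X) Y" and k: "k \<in> hom E W Z" and t: "t \<in> hom E W X"
  shows "app X Y (transpose E Z X Y f \<cdot> k) t = f \<cdot> pairing E k t"
proof -
  note X = hom_Obj_Cod[OF t] and Z = hom_Obj_Cod[OF k] and Y = hom_Obj_Cod[OF f]
  note T = transpose_hom[OF f X Z] and kt = pairing_hom[OF k t]
  have "f \<cdot> pairing E k t
      = app X Y (transpose E Z X Y f \<cdot> Proj1 E Z X) (Proj2 E Z X) \<cdot> pairing E k t"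
    by (simp add: app_transpose_Proj[OF f X Z])
  also have "\<dots> = app X Y ((transpose E Z X Y f \<cdot> Proj1 E Z X) \<cdot> pairing E k t)
      (Proj2 E Z X \<cdot> pairing E k t)"
    by (rule app_Comp[OF Comp_hom[OF Proj1_hom[OF Z X] T] Proj2_hom[OF Z X] Y kt])
  also have "\<dots> = app X Y (transpose E Z X Y f \<cdot> k) t"
    using Comp_assoc[OF kt Proj1_hom[OF Z X] T] Proj1_pairing[OF k t] Proj2_pairing[OF k t] by simp
  finally show ?thesis by simp
qed

lemma name_of_hom: "f \<in> hom E X Y \<Longrightarrow> name_of E f \<in> hom E (One E) (Exp E Y X)"
  using transpose_hom[OF Comp_hom[OF Proj2_hom[OF One_Obj hom_Obj_Dom]] hom_Obj_Dom One_Obj]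
  by (simp add: name_of_def hom_DomD hom_CodD)

text \<open>The beta rule for names. Leaving \<open>b\<close> general lets the rule apply directly
  whether the arrow to \<open>One E\<close> is a \<open>bang\<close> or a projection.\<close>

lemma app_name_of:
  assumes f: "f \<in> hom E X Y" and t: "t \<in> hom E Z X" and b: "b \<in> hom E Z (One E)"
  shows "app X Y (name_of E f \<cdot> b) t = f \<cdot> t"
proof -
  note P = Proj2_hom[OF One_Obj hom_Obj_Dom[OF f]]
  have "app X Y (name_of E f \<cdot> b) t = (f \<cdot> Proj2 E (One E) X) \<cdot> pairing E b t"
    unfolding name_of_def hom_DomD[OF f] hom_CodD[OF f]
    by (rule app_transpose[OF Comp_hom[OF P f] b t])
  also have "\<dots> = f \<cdot> t"
    using Comp_assoc[OF pairing_hom[OF b t] P f] Proj2_pairing[OF b t] by simp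
  finally show ?thesis .
qed

lemma const_exp_hom: "\<lbrakk>A \<in> Obj E; X \<in> Obj E\<rbrakk> \<Longrightarrow> const_exp E A X \<in> hom E X (Exp E X A)"
  unfolding const_exp_def by (simp add: transpose_hom Proj1_hom)

lemma app_const_exp:
  assumes x: "x \<in> hom E Z X" and t: "t \<in> hom E Z A"
  shows "app A X (const_exp E A X \<cdot> x) t = x"
  unfolding const_exp_def
  using app_transpose[OF Proj1_hom[OF hom_Obj_Cod[OF x] hom_Obj_Cod[OF t]] x t]
    Proj1_pairing[OF x t] by simp

text \<open>At the generic argument both sides have the constant value \<open>a\<close>. This links
  \<open>const_exp\<close> to the constant map in the definition of contractibility.\<close>

lemma const_exp_point:
  assumes a: "a \<in> hom E (One E) X" and A: "A \<in> Obj E"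
  shows "const_exp E A X \<cdot> a = name_of E (a \<cdot> bang E A)"
proof -
  note X = hom_Obj_Cod[OF a] and P1 = Proj1_hom[OF One_Obj A] and P2 = Proj2_hom[OF One_Obj A]
  note c = const_exp_hom[OF A X] and b = bang_hom[OF A]
  note ab = Comp_hom[OF b a]
  show ?thesis
  proof (rule Exp_ext[OF Comp_hom[OF a c] name_of_hom[OF ab] A X])
    have "app A X ((const_exp E A X \<cdot> a) \<cdot> Proj1 E (One E) A) (Proj2 E (One E) A)
        = a \<cdot> Proj1 E (One E) A"
      using app_const_exp[OF Comp_hom[OF P1 a] P2] Comp_assoc[OF P1 a c] by simp
    also have "\<dots> = a \<cdot> bang E A \<cdot> Proj2 E (One E) A"
      using hom_One_eq[OF P1 Comp_hom[OF P2 b]] by simp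
    also have "\<dots> = app A X (name_of E (a \<cdot> bang E A) \<cdot> Proj1 E (One E) A) (Proj2 E (One E) A)"
      using app_name_of[OF ab P2 P1] Comp_assoc[OF P2 b a] by simp
    finally show "app A X ((const_exp E A X \<cdot> a) \<cdot> Proj1 E (One E) A) (Proj2 E (One E) A)
        = app A X (name_of E (a \<cdot> bang E A) \<cdot> Proj1 E (One E) A) (Proj2 E (One E) A)" .
  qed
qed

section \<open>Internal composition\<close>

text \<open>The arrow \<open>Z\<^sup>Y \<times> Y\<^sup>X \<rightarrow> Z\<^sup>X\<close> sending
  \<open>(h, k)\<close> to the function with value \<open>h (k t)\<close> at \<open>t\<close>; the
  outer function is the first component.\<close>

definition int_comp :: "'o \<Rightarrow> 'o \<Rightarrow> 'o \<Rightarrow> 'm" where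
  "int_comp X Y Z =
    (let U = Exp E Z Y; V = Exp E Y X; W = Prod E U V in
      transpose E W X Z
        (app Y Z (Proj1 E U V \<cdot> Proj1 E W X)
           (app X Y (Proj2 E U V \<cdot> Proj1 E W X) (Proj2 E W X))))"

lemma
  assumes X: "X \<in> Obj E" and Y: "Y \<in> Obj E" and Z: "Z \<in> Obj E"
  shows int_comp_hom:
      "int_comp X Y Z \<in> hom E (Prod E (Exp E Z Y) (Exp E Y X)) (Exp E Z X)"
    and app_int_comp: "\<lbrakk>h \<in> hom E S (Exp E Z Y); k \<in> hom E S (Exp E Y X); t \<in> hom E S X\<rbrakk>
      \<Longrightarrow> app X Z (int_comp X Y Z \<cdot> pairing E h k) t = app Y Z h (app X Y k t)"
proof -
  let ?U = "Exp E Z Y" and ?V = "Exp E Y X"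
  let ?W = "Prod E ?U ?V"
  note U = Exp_Obj[OF Y Z] and V = Exp_Obj[OF X Y]
  note W = Prod_Obj[OF U V]
  note PU = Proj1_hom[OF U V] and PV = Proj2_hom[OF U V]
  note PW = Proj1_hom[OF W X] and PX = Proj2_hom[OF W X]
  note a = app_hom[OF Comp_hom[OF PW PV] PX Y]
  note b = app_hom[OF Comp_hom[OF PW PU] a Z]
  show "int_comp X Y Z \<in> hom E ?W (Exp E Z X)"
    unfolding int_comp_def Let_def by (rule transpose_hom[OF b X W])
  assume h: "h \<in> hom E S ?U" and k: "k \<in> hom E S ?V" and t: "t \<in> hom E S X"
  note hk = pairing_hom[OF h k]
  note q = pairing_hom[OF hk t]
  \<comment> \<open>The facts \<open>1\<close> and \<open>2\<close> substitute the triple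
    \<open>((h, k), t)\<close> at stage \<open>S\<close> for the projections in the body of
    \<open>int_comp\<close>.\<close>
  have 1: "(Proj1 E ?U ?V \<cdot> Proj1 E ?W X) \<cdot> pairing E (pairing E h k) t = h"
    using Comp_assoc[OF q PW PU] Proj1_pairing[OF hk t] Proj1_pairing[OF h k] by simp
  have 2: "(Proj2 E ?U ?V \<cdot> Proj1 E ?W X) \<cdot> pairing E (pairing E h k) t = k"
    using Comp_assoc[OF q PW PV] Proj1_pairing[OF hk t] Proj2_pairing[OF h k] by simp
  show "app X Z (int_comp X Y Z \<cdot> pairing E h k) t = app Y Z h (app X Y k t)"
    unfolding int_comp_def Let_def
    using app_transpose[OF b hk t] app_Comp[OF Comp_hom[OF PW PU] a Z q]
      app_Comp[OF Comp_hom[OF PW PV] PX Y q] 1 2 Proj2_pairing[OF hk t] by simp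
qed

section \<open>Composition with a fixed arrow\<close>

text \<open>This is the arrow \<open>X\<^sup>f\<close>, written so that \<open>f\<close> enters only
  through the point \<open>name_of E f\<close>: names that \<open>\<Pi>\<^sub>0\<close> identifies
  can then be exchanged inside the pairing.\<close>

lemma
  assumes X: "X \<in> Obj E" and f: "f \<in> hom E A B"
  shows precomp_hom: "int_comp A B X \<cdot> pairing E (Ident E (Exp E X B)) (name_of E f \<cdot> bang E (Exp E X B))
      \<in> hom E (Exp E X B) (Exp E X A)"
    and app_precomp: "\<lbrakk>h \<in> hom E Z (Exp E X B); t \<in> hom E Z A\<rbrakk> \<Longrightarrow>
      app A X ((int_comp A B X \<cdot> pairing E (Ident E (Exp E X B)) (name_of E f \<cdot> bang E (Exp E X B))) \<cdot> h) t
      = app B X h (f \<cdot> t)"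
proof -
  note A = hom_Obj_Dom[OF f] and B = hom_Obj_Cod[OF f]
  note V = Exp_Obj[OF B X] and c = int_comp_hom[OF A B X] and n = name_of_hom[OF f]
  note I = Ident_hom[OF V] and b = bang_hom[OF V]
  note nb = Comp_hom[OF b n]
  note q = pairing_hom[OF I nb]
  show "int_comp A B X \<cdot> pairing E (Ident E (Exp E X B)) (name_of E f \<cdot> bang E (Exp E X B))
      \<in> hom E (Exp E X B) (Exp E X A)"
    by (rule Comp_hom[OF q c])
  assume h: "h \<in> hom E Z (Exp E X B)" and t: "t \<in> hom E Z A"
  note bZ = bang_hom[OF hom_Obj_Dom[OF h]]
  have "pairing E (Ident E (Exp E X B)) (name_of E f \<cdot> bang E (Exp E X B)) \<cdot> h
      = pairing E h (name_of E f \<cdot> bang E Z)"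
    using pairing_Comp[OF I nb h] Comp_Ident_left[OF h] Comp_assoc[OF h b n] bang_Comp[OF h] by simp
  then show "app A X ((int_comp A B X \<cdot> pairing E (Ident E (Exp E X B)) (name_of E f \<cdot> bang E (Exp E X B))) \<cdot> h) t
      = app B X h (f \<cdot> t)"
    using Comp_assoc[OF h q c] app_int_comp[OF A B X h Comp_hom[OF bZ n] t]
      app_name_of[OF f t bZ] by simp
qed

text \<open>The same device for \<open>f\<^sup>X\<close>. Here \<open>f\<close> is applied last, so
  its name sits in the first component.\<close>

lemma
  assumes X: "X \<in> Obj E" and f: "f \<in> hom E A B"
  shows postcomp_hom: "int_comp X A B \<cdot> pairing E (name_of E f \<cdot> bang E (Exp E A X)) (Ident E (Exp E A X))
      \<in> hom E (Exp E A X) (Exp E B X)"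
    and app_postcomp: "\<lbrakk>h \<in> hom E Z (Exp E A X); t \<in> hom E Z X\<rbrakk> \<Longrightarrow>
      app X B ((int_comp X A B \<cdot> pairing E (name_of E f \<cdot> bang E (Exp E A X)) (Ident E (Exp E A X))) \<cdot> h) t
      = f \<cdot> app X A h t"
proof -
  note A = hom_Obj_Dom[OF f] and B = hom_Obj_Cod[OF f]
  note V = Exp_Obj[OF X A] and c = int_comp_hom[OF X A B] and n = name_of_hom[OF f]
  note I = Ident_hom[OF V] and b = bang_hom[OF V]
  note nb = Comp_hom[OF b n]
  note q = pairing_hom[OF nb I]
  show "int_comp X A B \<cdot> pairing E (name_of E f \<cdot> bang E (Exp E A X)) (Ident E (Exp E A X))
      \<in> hom E (Exp E A X) (Exp E B X)"
    by (rule Comp_hom[OF q c])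
  assume h: "h \<in> hom E Z (Exp E A X)" and t: "t \<in> hom E Z X"
  note bZ = bang_hom[OF hom_Obj_Dom[OF h]]
  have "pairing E (name_of E f \<cdot> bang E (Exp E A X)) (Ident E (Exp E A X)) \<cdot> h
      = pairing E (name_of E f \<cdot> bang E Z) h"
    using pairing_Comp[OF nb I h] Comp_Ident_left[OF h] Comp_assoc[OF h b n] bang_Comp[OF h] by simp
  then show "app X B ((int_comp X A B \<cdot> pairing E (name_of E f \<cdot> bang E (Exp E A X)) (Ident E (Exp E A X))) \<cdot> h) t
      = f \<cdot> app X A h t"
    using Comp_assoc[OF h q c] app_int_comp[OF X A B Comp_hom[OF bZ n] h t]
      app_name_of[OF f app_hom[OF h t A] bZ] by simp
qed

lemma precomp_Ident:
  assumes X: "X \<in> Obj E" and A: "A \<in> Obj E"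
  shows "int_comp A A X \<cdot>
      pairing E (Ident E (Exp E X A)) (name_of E (Ident E A) \<cdot> bang E (Exp E X A))
      = Ident E (Exp E X A)"
proof -
  note I = Ident_hom[OF A] and V = Exp_Obj[OF A X]
  note P1 = Proj1_hom[OF V A] and P2 = Proj2_hom[OF V A]
  show ?thesis
    using app_precomp[OF X I P1 P2] Comp_Ident_left[OF P1] Comp_Ident_left[OF P2]
    by (intro Exp_ext[OF precomp_hom[OF X I] Ident_hom[OF V] A X]) simp
qed

lemma postcomp_Ident:
  assumes X: "X \<in> Obj E" and A: "A \<in> Obj E"
  shows "int_comp X A A \<cdot>
      pairing E (name_of E (Ident E A) \<cdot> bang E (Exp E A X)) (Ident E (Exp E A X))
      = Ident E (Exp E A X)"
proof -
  note I = Ident_hom[OF A] and V = Exp_Obj[OF X A]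
  note P1 = Proj1_hom[OF V X] and P2 = Proj2_hom[OF V X]
  show ?thesis
    using app_postcomp[OF X I P1 P2] Comp_Ident_left[OF P1] Comp_Ident_left[OF app_hom[OF P1 P2 A]]
    by (intro Exp_ext[OF postcomp_hom[OF X I] Ident_hom[OF V] X A]) simp
qed

text \<open>At the generic argument both sides give the value of the generic function at
  \<open>a\<close>.\<close>

lemma precomp_const:
  assumes X: "X \<in> Obj E" and A: "A \<in> Obj E" and a: "a \<in> hom E (One E) A"
  shows "int_comp A A X \<cdot>
      pairing E (Ident E (Exp E X A)) (name_of E (a \<cdot> bang E A) \<cdot> bang E (Exp E X A))
      = const_exp E A X \<cdot> app A X (Ident E (Exp E X A)) (a \<cdot> bang E (Exp E X A))"
proof -
  note ab = Comp_hom[OF bang_hom[OF A] a] and V = Exp_Obj[OF A X]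
  note P1 = Proj1_hom[OF V A] and P2 = Proj2_hom[OF V A]
  note I = Ident_hom[OF V] and av = Comp_hom[OF bang_hom[OF V] a]
  note e = app_hom[OF I av X]
  note c = const_exp_hom[OF A X]
  \<comment> \<open>Seen over the product, \<open>a\<close> is the same along either projection,
    since both composites pass through the terminal object.\<close>
  have 1: "(a \<cdot> bang E A) \<cdot> Proj2 E (Exp E X A) A
      = (a \<cdot> bang E (Exp E X A)) \<cdot> Proj1 E (Exp E X A) A"
    using Comp_assoc[OF P2 bang_hom[OF A] a] Comp_assoc[OF P1 bang_hom[OF V] a]
      bang_Comp[OF P1] bang_Comp[OF P2] by simp
  show ?thesis
    using app_precomp[OF X ab P1 P2] Comp_assoc[OF P1 e c] app_const_exp[OF Comp_hom[OF P1 e] P2]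
      app_Comp[OF I av X P1] Comp_Ident_left[OF P1] 1
    by (intro Exp_ext[OF precomp_hom[OF X ab] Comp_hom[OF e c] A X]) simp
qed

text \<open>At the generic argument both sides give \<open>a\<close>, whatever the function; so this
  arrow factors through \<open>One E\<close>.\<close>

lemma postcomp_const:
  assumes X: "X \<in> Obj E" and A: "A \<in> Obj E" and a: "a \<in> hom E (One E) A"
  shows "int_comp X A A \<cdot>
      pairing E (name_of E (a \<cdot> bang E A) \<cdot> bang E (Exp E A X)) (Ident E (Exp E A X))
      = name_of E (a \<cdot> bang E X) \<cdot> bang E (Exp E A X)"
proof -
  note ab = Comp_hom[OF bang_hom[OF A] a] and V = Exp_Obj[OF X A]
  note P1 = Proj1_hom[OF V X] and P2 = Proj2_hom[OF V X]
  note ax = Comp_hom[OF bang_hom[OF X] a]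
  note n = name_of_hom[OF ax] and b = bang_hom[OF V]
  note e = app_hom[OF P1 P2 A]
  show ?thesis
    using app_postcomp[OF X ab P1 P2] Comp_assoc[OF P1 b n]
      app_name_of[OF ax P2 Comp_hom[OF P1 b]]
      Comp_assoc[OF e bang_hom[OF A] a] bang_Comp[OF e]
      Comp_assoc[OF P2 bang_hom[OF X] a] bang_Comp[OF P2]
    by (intro Exp_ext[OF postcomp_hom[OF X ab] Comp_hom[OF b n] X A]) simp
qed

end

section \<open>Arrows identified by the functor\<close>

context homotopy_theory
begin

lemma terminal_FObj_One: "is_terminal E (FObj \<Pi>\<^sub>0 (One E))"
  using finite_products One_terminal by (simp add: preserves_finite_products_def)

text \<open>The image of the product cone is again a product cone, so an arrow into it is determined
  by its two components, and these agree by assumption.\<close>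

lemma FArr_pairing_cong:
  assumes f: "f \<in> hom E Z X" "f' \<in> hom E Z X" "FArr \<Pi>\<^sub>0 f = FArr \<Pi>\<^sub>0 f'"
    and g: "g \<in> hom E Z Y" "g' \<in> hom E Z Y" "FArr \<Pi>\<^sub>0 g = FArr \<Pi>\<^sub>0 g'"
  shows "FArr \<Pi>\<^sub>0 (pairing E f g) = FArr \<Pi>\<^sub>0 (pairing E f' g')"
proof -
  note X = hom_Obj_Cod[OF f(1)] and Y = hom_Obj_Cod[OF g(1)] and Z = hom_Obj_Dom[OF f(1)]
  note P = Proj1_hom[OF X Y] Proj2_hom[OF X Y]
  have prod: "is_product E (FObj \<Pi>\<^sub>0 X) (FObj \<Pi>\<^sub>0 Y) (FObj \<Pi>\<^sub>0 (Prod E X Y))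
      (FArr \<Pi>\<^sub>0 (Proj1 E X Y)) (FArr \<Pi>\<^sub>0 (Proj2 E X Y))"
    using finite_products Prod_product[OF X Y] X Y
    by (auto simp: preserves_finite_products_def)
  have *: "FArr \<Pi>\<^sub>0 (pairing E u v) \<in> hom E (FObj \<Pi>\<^sub>0 Z) (FObj \<Pi>\<^sub>0 (Prod E X Y)) \<and>
      FArr \<Pi>\<^sub>0 (Proj1 E X Y) \<cdot> FArr \<Pi>\<^sub>0 (pairing E u v) = FArr \<Pi>\<^sub>0 u \<and>
      FArr \<Pi>\<^sub>0 (Proj2 E X Y) \<cdot> FArr \<Pi>\<^sub>0 (pairing E u v) = FArr \<Pi>\<^sub>0 v"
    if u: "u \<in> hom E Z X" and v: "v \<in> hom E Z Y" for u v
    using FArr_hom[OF pairing_hom[OF u v]] FArr_Comp[OF pairing_hom[OF u v]] P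
      Proj1_pairing[OF u v] Proj2_pairing[OF u v] by metis
  have "\<exists>!h. h \<in> hom E (FObj \<Pi>\<^sub>0 Z) (FObj \<Pi>\<^sub>0 (Prod E X Y)) \<and>
      FArr \<Pi>\<^sub>0 (Proj1 E X Y) \<cdot> h = FArr \<Pi>\<^sub>0 f \<and> FArr \<Pi>\<^sub>0 (Proj2 E X Y) \<cdot> h = FArr \<Pi>\<^sub>0 g"
    using prod FObj_Obj[OF Z] FArr_hom[OF f(1)] FArr_hom[OF g(1)]
    unfolding is_product_def by blast
  then show ?thesis
    using *[OF f(1) g(1)] *[OF f(2) g(2)] f(3) g(3) by metis
qed

text \<open>The component \<open>p 1\<close> is an arrow between terminal objects, hence invertible.\<close>

lemma FArr_point_eq:
  assumes x: "x \<in> hom E (One E) X" and y: "y \<in> hom E (One E) X"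
    and eq: "p X \<cdot> x = p X \<cdot> y"
  shows "FArr \<Pi>\<^sub>0 x = FArr \<Pi>\<^sub>0 y"
proof -
  let ?T = "FObj \<Pi>\<^sub>0 (One E)"
  note T = FObj_Obj[OF One_Obj]
  note q = bang_hom[OF T] and p1 = p_hom[OF One_Obj]
  have inv: "p (One E) \<cdot> bang E ?T = Ident E ?T"
    by (rule terminal_unique[OF terminal_FObj_One Comp_hom[OF q p1] Ident_hom[OF T]])
  \<comment> \<open>Naturality of \<open>p\<close> at \<open>z\<close> is solved for
    \<open>FArr \<Pi>\<^sub>0 z\<close> using the right inverse of \<open>p (One E)\<close>, which
    leaves an expression in \<open>p X \<cdot> z\<close>.\<close>
  have "FArr \<Pi>\<^sub>0 z = (p X \<cdot> z) \<cdot> bang E ?T" if z: "z \<in> hom E (One E) X" for z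
    using Comp_assoc[OF q p1 FArr_hom[OF z]] inv Comp_Ident_right[OF FArr_hom[OF z]]
      p_natural[OF z] by simp
  with x y eq show ?thesis by metis
qed

text \<open>Turns the homotopy, an equality after composing with \<open>p\<close>, into an equality
  of images under \<open>\<Pi>\<^sub>0\<close>, the form that the congruence lemmas accept.\<close>

lemma contractibleE:
  assumes "contractible E p A"
  obtains a where "a \<in> hom E (One E) A" "A \<in> Obj E"
    "FArr \<Pi>\<^sub>0 (name_of E (Ident E A)) = FArr \<Pi>\<^sub>0 (name_of E (a \<cdot> bang E A))"
proof -
  from assms obtain a where a: "a \<in> hom E (One E) A"
    and h: "homotopic E p A A (Ident E A) (a \<cdot> bang E A)"
    unfolding contractible_def by blast
  have I: "Ident E A \<in> hom E A A" and ab: "a \<cdot> bang E A \<in> hom E A A"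
    and eq: "p (Exp E A A) \<cdot> name_of E (Ident E A) = p (Exp E A A) \<cdot> name_of E (a \<cdot> bang E A)"
    using h by (auto simp: homotopic_def)
  show thesis
    using that[OF a hom_Obj_Dom[OF I] FArr_point_eq[OF name_of_hom[OF I] name_of_hom[OF ab] eq]] .
qed

lemma FArr_Comp_cong:
  assumes "f \<in> hom E X Y" "f' \<in> hom E X Y" "g \<in> hom E Y Z" "g' \<in> hom E Y Z"
    "FArr \<Pi>\<^sub>0 f = FArr \<Pi>\<^sub>0 f'" "FArr \<Pi>\<^sub>0 g = FArr \<Pi>\<^sub>0 g'"
  shows "FArr \<Pi>\<^sub>0 (g \<cdot> f) = FArr \<Pi>\<^sub>0 (g' \<cdot> f')"
  using assms FArr_Comp by metis

section \<open>Contractibility and the maps \<open>const_exp\<close>\<close>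

lemma contractible_imp_iso_const_exp:
  assumes "contractible E p A" and X: "X \<in> Obj E"
  shows "is_iso E (FArr \<Pi>\<^sub>0 (const_exp E A X))"
proof -
  from assms(1) obtain a where a: "a \<in> hom E (One E) A" and A: "A \<in> Obj E"
    and eq: "FArr \<Pi>\<^sub>0 (name_of E (Ident E A)) = FArr \<Pi>\<^sub>0 (name_of E (a \<cdot> bang E A))"
    by (rule contractibleE)
  note V = Exp_Obj[OF A X]
  let ?V = "Exp E X A"
  let ?ev = "app A X (Ident E ?V) (a \<cdot> bang E ?V)"
  note I = Ident_hom[OF V] and av = Comp_hom[OF bang_hom[OF V] a]
  note e = app_hom[OF I av X] and c = const_exp_hom[OF A X]
  note n1 = name_of_hom[OF Ident_hom[OF A]] and n2 = name_of_hom[OF Comp_hom[OF bang_hom[OF A] a]]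
  note b = bang_hom[OF V] and ic = int_comp_hom[OF A A X]
  \<comment> \<open>By \<open>precomp_Ident\<close> and \<open>precomp_const\<close> the two sides
    are images of precomposition with the identity and with the constant map, whose names
    \<open>\<Pi>\<^sub>0\<close> identifies.\<close>
  have "FArr \<Pi>\<^sub>0 (Ident E ?V) = FArr \<Pi>\<^sub>0 (const_exp E A X \<cdot> ?ev)"
    unfolding precomp_const[OF X A a, symmetric]
    using FArr_Comp_cong[OF pairing_hom[OF I Comp_hom[OF b n1]] pairing_hom[OF I Comp_hom[OF b n2]]
        ic ic FArr_pairing_cong[OF I I refl Comp_hom[OF b n1] Comp_hom[OF b n2]
          FArr_Comp_cong[OF b b n1 n2 refl eq]] refl] precomp_Ident[OF X A] by simp
  then have 1: "FArr \<Pi>\<^sub>0 (const_exp E A X) \<cdot> FArr \<Pi>\<^sub>0 ?ev = Ident E (FObj \<Pi>\<^sub>0 ?V)"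
    using FArr_Ident[OF V] FArr_Comp[OF e c] by simp
  \<comment> \<open>The other composite is the identity already in \<open>E\<close>: a constant
    function evaluated at \<open>a\<close> returns its constant.\<close>
  have "(a \<cdot> bang E ?V) \<cdot> const_exp E A X = a \<cdot> bang E X"
    using Comp_assoc[OF c b a] bang_Comp[OF c] by simp
  then have "?ev \<cdot> const_exp E A X = app A X (const_exp E A X \<cdot> Ident E X) (a \<cdot> bang E X)"
    using app_Comp[OF I av X c] Comp_Ident_left[OF c] Comp_Ident_right[OF c] by simp
  also have "\<dots> = Ident E X"
    by (rule app_const_exp[OF Ident_hom[OF X] Comp_hom[OF bang_hom[OF X] a]])
  finally have 2: "FArr \<Pi>\<^sub>0 ?ev \<cdot> FArr \<Pi>\<^sub>0 (const_exp E A X) = Ident E (FObj \<Pi>\<^sub>0 X)"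
    using FArr_Ident[OF X] FArr_Comp[OF c e] by simp
  show ?thesis
    by (rule is_isoI[OF FArr_hom[OF c] FArr_hom[OF e] 2 1])
qed

lemma iso_const_exp_imp_contractible:
  assumes A: "A \<in> Obj E" and iso: "is_iso E (FArr \<Pi>\<^sub>0 (const_exp E A A))"
  shows "contractible E p A"
proof -
  note V = Exp_Obj[OF A A] and c = const_exp_hom[OF A A]
  note n = name_of_hom[OF Ident_hom[OF A]] and Fc = FArr_hom[OF const_exp_hom[OF A A]]
  note pn = Comp_hom[OF n p_hom[OF V]]
  obtain g where g: "g \<in> hom E (FObj \<Pi>\<^sub>0 (Exp E A A)) (FObj \<Pi>\<^sub>0 A)"
    and cg: "FArr \<Pi>\<^sub>0 (const_exp E A A) \<cdot> g = Ident E (FObj \<Pi>\<^sub>0 (Exp E A A))"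
    using is_isoE[OF iso Fc] by metis
  \<comment> \<open>The inverse \<open>g\<close> moves the class of the identity's name to a point
    of \<open>FObj \<Pi>\<^sub>0 A\<close>; surjectivity on points lifts it to the contraction point
    \<open>a\<close>.\<close>
  have "g \<cdot> p (Exp E A A) \<cdot> name_of E (Ident E A) \<in> hom E (One E) (FObj \<Pi>\<^sub>0 A)"
    by (rule Comp_hom[OF pn g])
  then obtain a where a: "a \<in> hom E (One E) A"
    and pa: "g \<cdot> p (Exp E A A) \<cdot> name_of E (Ident E A) = p A \<cdot> a"
    using points_surj[OF A] by blast
  have "p (Exp E A A) \<cdot> name_of E (Ident E A) = FArr \<Pi>\<^sub>0 (const_exp E A A) \<cdot> p A \<cdot> a"
    using Comp_assoc[OF pn g Fc] cg Comp_Ident_left[OF pn] pa by simp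
  \<comment> \<open>Naturality of \<open>p\<close> at \<open>const_exp E A A\<close> brings the
    equation back from \<open>\<Pi>\<^sub>0\<close> to points of the exponential.\<close>
  also have "\<dots> = p (Exp E A A) \<cdot> const_exp E A A \<cdot> a"
    using Comp_assoc[OF a p_hom[OF A] Fc] p_natural[OF c] Comp_assoc[OF a c p_hom[OF V]] by simp
  also have "\<dots> = p (Exp E A A) \<cdot> name_of E (a \<cdot> bang E A)"
    using const_exp_point[OF a A] by simp
  finally show ?thesis
    using a Ident_hom[OF A] Comp_hom[OF bang_hom[OF A] a]
    unfolding contractible_def homotopic_def by blast
qed

section \<open>Contractibility and connected exponentials\<close>

lemma contractible_imp_connected_Exp:
  assumes "contractible E p A" and X: "X \<in> Obj E"
  shows "connected_object E \<Pi>\<^sub>0 (Exp E A X)"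
proof -
  from assms(1) obtain a where a: "a \<in> hom E (One E) A" and A: "A \<in> Obj E"
    and eq: "FArr \<Pi>\<^sub>0 (name_of E (Ident E A)) = FArr \<Pi>\<^sub>0 (name_of E (a \<cdot> bang E A))"
    by (rule contractibleE)
  let ?V = "Exp E A X"
  note V = Exp_Obj[OF X A]
  note I = Ident_hom[OF V] and b = bang_hom[OF V] and ic = int_comp_hom[OF X A A]
  note n1 = name_of_hom[OF Ident_hom[OF A]] and n2 = name_of_hom[OF Comp_hom[OF bang_hom[OF A] a]]
  note k = name_of_hom[OF Comp_hom[OF bang_hom[OF X] a]]
  \<comment> \<open>Both sides are images of postcomposition arrows, with the identity on the left
    and the constant map on the right.\<close>
  have "FArr \<Pi>\<^sub>0 (Ident E ?V) = FArr \<Pi>\<^sub>0 (name_of E (a \<cdot> bang E X) \<cdot> bang E ?V)"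
    unfolding postcomp_const[OF X A a, symmetric]
    using FArr_Comp_cong[OF pairing_hom[OF Comp_hom[OF b n1] I] pairing_hom[OF Comp_hom[OF b n2] I]
        ic ic FArr_pairing_cong[OF Comp_hom[OF b n1] Comp_hom[OF b n2]
          FArr_Comp_cong[OF b b n1 n2 refl eq] I I refl] refl] postcomp_Ident[OF X A] by simp
  then have "FArr \<Pi>\<^sub>0 (name_of E (a \<cdot> bang E X)) \<cdot> FArr \<Pi>\<^sub>0 (bang E ?V) = Ident E (FObj \<Pi>\<^sub>0 ?V)"
    using FArr_Ident[OF V] FArr_Comp[OF b k] by simp
  then show ?thesis
    unfolding connected_object_def
    by (rule retract_of_terminal[OF terminal_FObj_One FArr_hom[OF k] FArr_hom[OF b]])
qed

text \<open>A terminal object has a point, and surjectivity on points lifts it along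
  \<open>p X\<close>.\<close>

lemma connected_imp_has_point:
  assumes X: "X \<in> Obj E" and "connected_object E \<Pi>\<^sub>0 X"
  shows "has_point E X"
proof -
  have "\<exists>!f. f \<in> hom E (One E) (FObj \<Pi>\<^sub>0 X)"
    using assms(2) One_Obj unfolding connected_object_def is_terminal_def by blast
  then show ?thesis
    using points_surj[OF X] unfolding has_point_def by blast
qed

text \<open>A point of the exponential, applied to the identity of \<open>One E\<close>, yields a
  point of \<open>A\<close>.\<close>

lemma connected_Exp_One_imp_has_point:
  assumes A: "A \<in> Obj E" and "connected_object E \<Pi>\<^sub>0 (Exp E A (One E))"
  shows "has_point E A"
proof -
  obtain h where "h \<in> hom E (One E) (Exp E A (One E))"
    using connected_imp_has_point[OF Exp_Obj[OF One_Obj A] assms(2)]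
    unfolding has_point_def by blast
  from app_hom[OF this Ident_hom[OF One_Obj] A] show ?thesis
    unfolding has_point_def by blast
qed

text \<open>The point supplies a constant map; its name and that of the identity become equal after
  \<open>p\<close>, which lands in a terminal object.\<close>

lemma connected_Exp_imp_contractible:
  assumes A: "A \<in> Obj E" and "has_point E A" and conn: "connected_object E \<Pi>\<^sub>0 (Exp E A A)"
  shows "contractible E p A"
proof -
  obtain a where a: "a \<in> hom E (One E) A" using assms(2) unfolding has_point_def by blast
  note I = Ident_hom[OF A] and ab = Comp_hom[OF bang_hom[OF A] a]
  note pV = p_hom[OF Exp_Obj[OF A A]]
  have "p (Exp E A A) \<cdot> name_of E (Ident E A) = p (Exp E A A) \<cdot> name_of E (a \<cdot> bang E A)"
    using conn unfolding connected_object_def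
    by (rule terminal_unique[OF _ Comp_hom[OF name_of_hom[OF I] pV] Comp_hom[OF name_of_hom[OF ab] pV]])
  then show ?thesis
    using a I ab unfolding contractible_def homotopic_def by blast
qed

end

theorem theoremD:
  fixes E :: "('o, 'm) ccc"
    and \<Pi>\<^sub>0 :: "('o, 'm) endofunctor"
    and p :: "'o \<Rightarrow> 'm"
    and A :: 'o
  assumes "cartesian_closed_category E"
    and "homotopy_theory E \<Pi>\<^sub>0 p"
    and "A \<in> Obj E"
  shows "(contractible E p A \<longleftrightarrow> (\<forall>X \<in> Obj E. is_iso E (FArr \<Pi>\<^sub>0 (const_exp E A X))))
    \<and> (topos E \<and> NS E \<and> WDQO E \<and> DSO E \<and> associated_homotopy_theory E \<Pi>\<^sub>0 p \<longrightarrow>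
        (contractible E p A \<longleftrightarrow> (\<forall>X \<in> Obj E. connected_object E \<Pi>\<^sub>0 (Exp E A X)))
      \<and> (contractible E p A \<longleftrightarrow> has_point E A \<and> connected_object E \<Pi>\<^sub>0 (Exp E A A)))"
proof -
  interpret homotopy_theory E \<Pi>\<^sub>0 p by (rule assms(2))
  note A = assms(3)
  have iso: "contractible E p A \<longleftrightarrow> (\<forall>X \<in> Obj E. is_iso E (FArr \<Pi>\<^sub>0 (const_exp E A X)))"
    using contractible_imp_iso_const_exp iso_const_exp_imp_contractible[OF A] A by blast
  have 3: "\<forall>X \<in> Obj E. connected_object E \<Pi>\<^sub>0 (Exp E A X)" if "contractible E p A"
    using contractible_imp_connected_Exp[OF that] by blast
  have 4: "has_point E A \<and> connected_object E \<Pi>\<^sub>0 (Exp E A A)"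
    if "\<forall>X \<in> Obj E. connected_object E \<Pi>\<^sub>0 (Exp E A X)"
    using connected_Exp_One_imp_has_point[OF A] that A One_Obj by blast
  show ?thesis
    \<comment> \<open>The last two equivalences form a cycle: contractibility, connectedness of
      every \<open>Exp E A X\<close>, a point with connected \<open>Exp E A A\<close>, and
      contractibility again.\<close>
    using iso 3 4 connected_Exp_imp_contractible[OF A] by blast
qed

end
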